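(* Consider a relaxation method based on a time integration method of order $p\ge 2$ for the ODE $u'(t)=f(u(t))$. If $\eta$ is a general (i.e. not necessarily convex) smooth functional, $\Delta t$ is sufficiently small, and $$\eta'(u^{\mathrm{new}})\,\frac{u^{\mathrm{new}}-u^{\mathrm{old}}}{\|u^{\mathrm{new}}-u^{\mathrm{old}}\|}=c\,\Delta t+\mathcal{O}(\Delta t^{2})\quad\text{with } c\neq 0,$$ then there is a unique $\gamma=1+\mathcal{O}(\Delta t^{p-1})$ that satisfies the relaxation condition $$\eta\bigl(u^{\mathrm{old}}+\gamma(u^{\mathrm{new}}-u^{\mathrm{old}})\bigr)=\eta^{\mathrm{old}}+\gamma(\eta^{\mathrm{new}}-\eta^{\mathrm{old}}),$$ and the resulting relaxation method is of order $p$, i.e. $u^n_\gamma=u(t^n_\gamma)+\mathcal{O}(\Delta t^{p+1})$.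
   Context: Setting. $u'(t)=f(u(t))$ is an ODE in a Banach space with smooth $f$, and $u$ is a (smooth) solution. All $\mathcal{O}(\cdot)$ refer to the limit $\Delta t\to 0$; inside $\mathcal{O}(\cdot)$, superscripts of $\Delta t$ are exponents, whereas superscripts of $t$ and $u$ are time step indices. The constant $c$ is independent of $\Delta t$. Baseline method. A $k$-step time integration method computes $u^{\mathrm{new}}=\psi(f,\Delta t,u^{n-1},\dots,u^{n-k})$ as an approximation at time $t^{\mathrm{new}}=t^{n-1}+\Delta t$. Order is understood in the local sense: for previous values with $u^{n-j}=u(t^{n-j})+\mathcal{O}(\Delta t^{p+1})$ at previous times $t^{n-j}$ (increasing in the index, with spacings $\mathcal{O}(\Delta t)$), one has $u^{\mathrm{new}}=u(t^{\mathrm{new}})+\mathcal{O}(\Delta t^{p+1})$. Old values. Fix $m\ge1$ and weights $\nu_0,\dots,\nu_{m-1}\ge 0$ with $\sum_i\nu_i=1$, and set $t^{\mathrm{old}}=\sum_{i=0}^{m-1}\nu_i t^{n-m+i}$, $u^{\mathrm{old}}=\sum_{i=0}^{m-1}\nu_i u^{n-m+i}$, $\eta^{\mathrm{old}}=\sum_{i=0}^{m-1}\nu_i\,\eta(u^{n-m+i})$. Estimate. $\eta^{\mathrm{new}}$ is a given number with $\eta^{\mathrm{new}}=\eta(u^{\mathrm{new}})+\mathcal{O}(\Delta t^{p+1})$ (for invariants one takes $\eta^{\mathrm{new}}=\eta^{\mathrm{old}}$). Relaxation method. $u^n_\gamma=u^{\mathrm{old}}+\gamma(u^{\mathrm{new}}-u^{\mathrm{old}})$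 and $t^n_\gamma=t^{\mathrm{old}}+\gamma(t^{\mathrm{new}}-t^{\mathrm{old}})$, with $\gamma$ chosen to satisfy the relaxation condition; the integration is continued with $(t^n_\gamma,u^n_\gamma)$ in place of $(t^{\mathrm{new}},u^{\mathrm{new}})$.
   Formalization: Two hypotheses are added, as the claim fails without them: u is not a steady state (f(u) ≠ 0 along u), and |cΔt − (η^new − η^old)/‖u^new − u^old‖| ≥ κΔt for some κ > 0 and all small Δt; for invariants the latter is just c ≠ 0. *)

theory Defs
  imports "HOL-Analysis.Analysis" "HOL-Library.Landau_Symbols"
begin

definition bounded_multilinear ::
    "nat \<Rightarrow> ('a::real_normed_vector list \<Rightarrow> 'b::real_normed_vector) \<Rightarrow> bool" where
  "bounded_multilinear k M \<longleftrightarrow>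
     (\<forall>us ws. Suc (length us + length ws) = k \<longrightarrow> linear (\<lambda>x. M (us @ x # ws))) \<and>
     (\<exists>C. \<forall>vs. length vs = k \<longrightarrow> norm (M vs) \<le> C * prod_list (map norm vs))"

(* Infinite Frechet differentiability on the whole space.  D k x is the k-th derivative at x,
   a bounded k-linear map whose arguments form a list of length k; D (Suc k) is the Frechet
   derivative of D k for the operator norm of k-linear maps, since the bound e * norm h is
   uniform in the remaining arguments vs. *)
definition smooth :: "('a::real_normed_vector \<Rightarrow> 'b::real_normed_vector) \<Rightarrow> bool" where
  "smooth g \<longleftrightarrow>
     (\<exists>D :: nat \<Rightarrow> 'a \<Rightarrow> 'a list \<Rightarrow> 'b.
        (\<forall>x. D 0 x [] = g x) \<and>
        (\<forall>k x. bounded_multilinear k (D k x)) \<and>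
        (\<forall>k x. \<forall>e>0. \<exists>d>0. \<forall>h. norm h < d \<longrightarrow>
           (\<forall>vs. length vs = k \<longrightarrow>
              norm (D k (x + h) vs - D k x vs - D (Suc k) x (h # vs))
                \<le> e * norm h * prod_list (map norm vs))))"

definition solves_ode :: "('a::banach \<Rightarrow> 'a) \<Rightarrow> (real \<Rightarrow> 'a) \<Rightarrow> real set \<Rightarrow> bool" where
  "solves_ode f u J \<longleftrightarrow>
     open J \<and> is_interval J \<and> (\<forall>t\<in>J. (u has_vector_derivative f (u t)) (at t))"

(* All data of a step are families indexed by the step size h > 0, and asymptotics are taken
   along at_right 0.  For a family x of data at the previous steps, x h j is the item with time
   step index n - j, so the index j counts backwards, starting at 1.

   The first conjunct makes the O-terms uniform: the previous times may move with h, but they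
   stay in a compact part of the interval of existence. *)
definition previous_times :: "real set \<Rightarrow> nat \<Rightarrow> (real \<Rightarrow> nat \<Rightarrow> real) \<Rightarrow> bool" where
  "previous_times J N t \<longleftrightarrow>
     (\<exists>a b. {a..b} \<subseteq> J \<and> (\<forall>\<^sub>F h in at_right 0. \<forall>j\<in>{1..N}. t h j \<in> {a..b})) \<and>
     (\<forall>\<^sub>F h in at_right 0. \<forall>j\<in>{1..<N}. t h (Suc j) < t h j) \<and>
     (\<forall>j\<in>{1..<N}. (\<lambda>h. t h j - t h (Suc j)) \<in> O[at_right 0](\<lambda>h. h))"

definition accurate_values ::
    "nat \<Rightarrow> nat \<Rightarrow> (real \<Rightarrow> 'a::real_normed_vector) \<Rightarrow> (real \<Rightarrow> nat \<Rightarrow> real) \<Rightarrow>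
      (real \<Rightarrow> nat \<Rightarrow> 'a) \<Rightarrow> bool" where
  "accurate_values p N u t v \<longleftrightarrow>
     (\<forall>j\<in>{1..N}. (\<lambda>h. norm (v h j - u (t h j))) \<in> O[at_right 0](\<lambda>h. h ^ (p + 1)))"

type_synonym 'a time_integrator = "('a \<Rightarrow> 'a) \<Rightarrow> real \<Rightarrow> 'a list \<Rightarrow> 'a"

definition method_step ::
    "'a time_integrator \<Rightarrow> nat \<Rightarrow> ('a \<Rightarrow> 'a) \<Rightarrow> (real \<Rightarrow> nat \<Rightarrow> 'a) \<Rightarrow> real \<Rightarrow> 'a" where
  "method_step \<psi> k f v h = \<psi> f h (map (v h) [1..<Suc k])"

(* Local order of a k-step method for the ODE given by f, on the family t of previous times.
   The times are a parameter because the order of a multistep method depends on them: a method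
   with fixed coefficients has its order on equispaced times only, and a variable-step method
   has coefficients depending on the spacings, which enter \<psi> through its argument h. *)
definition has_order ::
    "'a::banach time_integrator \<Rightarrow> nat \<Rightarrow> ('a \<Rightarrow> 'a) \<Rightarrow> (real \<Rightarrow> nat \<Rightarrow> real) \<Rightarrow> nat \<Rightarrow> bool" where
  "has_order \<psi> k f t p \<longleftrightarrow>
     (\<forall>J u v. solves_ode f u J \<longrightarrow> previous_times J k t \<longrightarrow> accurate_values p k u t v \<longrightarrow>
        (\<lambda>h. norm (method_step \<psi> k f v h - u (t h 1 + h))) \<in> O[at_right 0](\<lambda>h. h ^ (p + 1)))"

(* The weight \<nu> i belongs to the time step index n - m + i = n - (m - i). *)
definition old_average :: "nat \<Rightarrow> (nat \<Rightarrow> real) \<Rightarrow> (nat \<Rightarrow> 'b::real_vector) \<Rightarrow> 'b" where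
  "old_average m \<nu> x = (\<Sum>i<m. \<nu> i *\<^sub>R x (m - i))"

definition relax :: "real \<Rightarrow> 'b::real_vector \<Rightarrow> 'b \<Rightarrow> 'b" where
  "relax \<gamma> old new = old + \<gamma> *\<^sub>R (new - old)"

definition relaxation_parameter ::
    "nat \<Rightarrow> ('a::real_normed_vector \<Rightarrow> real) \<Rightarrow> (real \<Rightarrow> 'a) \<Rightarrow> (real \<Rightarrow> 'a) \<Rightarrow>
      (real \<Rightarrow> real) \<Rightarrow> (real \<Rightarrow> real) \<Rightarrow> (real \<Rightarrow> real) \<Rightarrow> bool" where
  "relaxation_parameter p \<eta> u_old u_new \<eta>_old \<eta>_new \<gamma> \<longleftrightarrow>
     (\<lambda>h. \<gamma> h - 1) \<in> O[at_right 0](\<lambda>h. h ^ (p - 1)) \<and>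
     (\<forall>\<^sub>F h in at_right 0.
        \<eta> (relax (\<gamma> h) (u_old h) (u_new h)) = relax (\<gamma> h) (\<eta>_old h) (\<eta>_new h))"

end

theory Submission
  imports Defs
begin

text \<open>
  Write \<open>d = u_new - u_old\<close> and let \<open>g \<gamma>\<close> be the residual of the relaxation condition.  Since the solution
  is nowhere stationary on a compact part of its interval of existence, \<open>norm d\<close> is of exact order \<open>h\<close>.
  Then \<open>g 1\<close> is of order \<open>h ^ (p + 1)\<close>, the slope condition and nondegeneracy bound the modulus of the
  derivative of \<open>g\<close> at \<open>1\<close> below by a multiple of \<open>h\<^sup>2\<close>, and this derivative varies on a ball of fixed
  radius \<open>\<rho>\<close> around \<open>1\<close> by at most \<open>\<rho>\<close> times a multiple of \<open>h\<^sup>2\<close>.  For small \<open>\<rho>\<close>, independent of \<open>h\<close>,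
  \<open>g\<close> is therefore injective there and the intermediate value theorem yields a root at a distance from
  \<open>1\<close> of order \<open>h ^ (p - 1)\<close>.  The relaxed point differs from the new one by \<open>(\<gamma> - 1) d\<close>, and \<open>d\<close> agrees with
  \<open>(t_new - t_old) f (u t_new)\<close> up to \<open>h\<^sup>2\<close>, so moving the time along keeps the order.
\<close>

section \<open>Derivatives of smooth maps\<close>

text \<open>A Lebesgue number argument, where \<open>P y B\<close> is read as a bound
  \<open>B\<close> on some quantity at \<open>y\<close>. In infinite dimensions a neighbourhood of a
  compact set need not be relatively compact, so a single bound on a uniform neighbourhood of
  \<open>K\<close> has to come from a finite subcover; halving the radii leaves room for the
  triangle inequality.\<close>

lemma compact_locally_bounded:
  fixes K :: "'a::metric_space set" and P :: "'a \<Rightarrow> real \<Rightarrow> bool"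
  assumes "compact K"
    and loc: "\<And>x. x \<in> K \<Longrightarrow> \<exists>r>0. \<exists>B. \<forall>y\<in>ball x r. P y B"
    and mono: "\<And>y B C. P y B \<Longrightarrow> B \<le> C \<Longrightarrow> P y C"
  obtains r B where "0 < r" "0 \<le> B" "\<And>x y. x \<in> K \<Longrightarrow> y \<in> ball x r \<Longrightarrow> P y B"
proof -
  obtain r B where rB: "\<And>x. x \<in> K \<Longrightarrow> 0 < r x \<and> (\<forall>y\<in>ball x (r x). P y (B x))"
    using loc by metis
  obtain T where T: "T \<subseteq> K" "finite T" "K \<subseteq> (\<Union>x\<in>T. ball x (r x / 2))"
  proof (rule compactE_image[OF \<open>compact K\<close>])
    show "K \<subseteq> (\<Union>x\<in>K. ball x (r x / 2))"
      using rB by (auto intro!: bexI)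
  qed auto
  \<comment> \<open>\<open>insert 1\<close> and \<open>insert 0\<close> keep \<open>Min\<close> and
    \<open>Max\<close> meaningful for empty \<open>T\<close>; the latter also makes \<open>C\<close>
    nonnegative.\<close>
  define d where "d = Min (insert 1 ((\<lambda>x. r x / 2) ` T))"
  define C where "C = Max (insert 0 (B ` T))"
  have "\<forall>x\<in>T. 0 < r x"
    using rB T by blast
  then have "0 < d"
    unfolding d_def using T(2) by simp
  moreover have "0 \<le> C"
    unfolding C_def using T by (intro Max_ge) auto
  moreover have "P y C" if "x \<in> K" "y \<in> ball x d" for x y
  proof -
    obtain z where z: "z \<in> T" "dist z x < r z / 2"
      using T \<open>x \<in> K\<close> by auto
    have "d \<le> r z / 2"
      unfolding d_def using T z by (intro Min_le) auto
    then have "dist z y < r z"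
      using z that dist_triangle[of z y x] by simp
    then have "P y (B z)"
      using rB z T by auto
    moreover have "B z \<le> C"
      unfolding C_def using T z by (intro Max_ge) auto
    ultimately show ?thesis by (rule mono)
  qed
  ultimately show ?thesis by (rule that)
qed

text \<open>Turns \<open>smooth\<close> into directly usable facts: each derivative is
  differentiable once its arguments are frozen, and it is bounded uniformly near a compact set. The
  bound holds because the first-order expansion of \<open>D k\<close> at \<open>x\<close> is uniform
  in \<open>vs\<close>, so that bounds on \<open>D k x\<close> and \<open>D (Suc k) x\<close> carry
  over to a ball around \<open>x\<close>.\<close>

lemma smooth_derivatives:
  fixes g :: "'a::real_normed_vector \<Rightarrow> 'b::real_normed_vector"
  assumes "smooth g"
  obtains D :: "nat \<Rightarrow> 'a \<Rightarrow> 'a list \<Rightarrow> 'b" where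
    "\<And>x. D 0 x [] = g x"
    "\<And>x vs. ((\<lambda>x. D (length vs) x vs) has_derivative (\<lambda>h. D (Suc (length vs)) x (h # vs))) (at x)"
    "\<And>k K. compact K \<Longrightarrow> \<exists>r>0. \<exists>B\<ge>0. \<forall>x\<in>K. \<forall>y\<in>ball x r. \<forall>vs. length vs = k \<longrightarrow>
        norm (D k y vs) \<le> B * prod_list (map norm vs)"
proof -
  obtain D :: "nat \<Rightarrow> 'a \<Rightarrow> 'a list \<Rightarrow> 'b" where
    D0: "\<And>x. D 0 x [] = g x"
    and ml: "\<And>k x. bounded_multilinear k (D k x)"
    and der: "\<And>k x e. 0 < e \<Longrightarrow> \<exists>d>0. \<forall>h. norm h < d \<longrightarrow> (\<forall>vs. length vs = k \<longrightarrow>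
       norm (D k (x + h) vs - D k x vs - D (Suc k) x (h # vs)) \<le> e * norm h * prod_list (map norm vs))"
    using assms unfolding smooth_def by blast
  have bdd: "\<exists>B\<ge>0. \<forall>vs. length vs = k \<longrightarrow> norm (D k x vs) \<le> B * prod_list (map norm vs)" for k x
  proof -
    obtain B where B: "\<And>vs. length vs = k \<Longrightarrow> norm (D k x vs) \<le> B * prod_list (map norm vs)"
      using ml[of k x] unfolding bounded_multilinear_def by blast
    have "0 \<le> prod_list (map norm vs)" for vs :: "'a list"
      by (induction vs) auto
    then have "B * prod_list (map norm vs) \<le> \<bar>B\<bar> * prod_list (map norm vs)" for vs :: "'a list"
      by (intro mult_right_mono) auto
    then show ?thesis
      using B by (intro exI[of _ "\<bar>B\<bar>"]) (auto intro: order_trans)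
  qed
  have "((\<lambda>x. D (length vs) x vs) has_derivative (\<lambda>h. D (Suc (length vs)) x (h # vs))) (at x)" for x vs
    unfolding has_derivative_at_alt
  proof (intro conjI allI impI)
    obtain B where B: "\<And>ws. length ws = Suc (length vs) \<Longrightarrow>
        norm (D (Suc (length vs)) x ws) \<le> B * prod_list (map norm ws)"
      using bdd by metis
    show "bounded_linear (\<lambda>h. D (Suc (length vs)) x (h # vs))"
    proof (rule bounded_linear_intro[where K = "B * prod_list (map norm vs)"])
      have "linear (\<lambda>h. D (Suc (length vs)) x ([] @ h # vs))"
        using ml[of "Suc (length vs)" x] unfolding bounded_multilinear_def by (metis add_0 list.size(3))
      then have lin: "linear (\<lambda>h. D (Suc (length vs)) x (h # vs))"
        by simp
      show "D (Suc (length vs)) x ((h + h') # vs) =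
          D (Suc (length vs)) x (h # vs) + D (Suc (length vs)) x (h' # vs)" for h h'
        using linear_add[OF lin] by simp
      show "D (Suc (length vs)) x ((r *\<^sub>R h) # vs) = r *\<^sub>R D (Suc (length vs)) x (h # vs)" for r h
        using linear_scale[OF lin] by simp
      show "norm (D (Suc (length vs)) x (h # vs)) \<le> norm h * (B * prod_list (map norm vs))" for h
        using B[of "h # vs"] by (simp add: mult_ac)
    qed
  next
    fix e :: real assume "0 < e"
    define q where "q = prod_list (map norm vs)"
    have "0 \<le> q"
      unfolding q_def by (induction vs) auto
    \<comment> \<open>Dividing by \<open>q + 1\<close> instead of \<open>q\<close> covers the case
      \<open>q = 0\<close>.\<close>
    obtain d where "0 < d" and d: "\<And>h. norm h < d \<Longrightarrow>
       norm (D (length vs) (x + h) vs - D (length vs) x vs - D (Suc (length vs)) x (h # vs))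
         \<le> e / (q + 1) * norm h * q"
      using der[of "e / (q + 1)" "length vs" x] \<open>0 < e\<close> \<open>0 \<le> q\<close> unfolding q_def by (auto simp: divide_simps)
    have "e / (q + 1) * n * q \<le> e * n" if "0 \<le> n" for n :: real
      using \<open>0 < e\<close> \<open>0 \<le> q\<close> that by (simp add: field_simps)
    then have "norm (D (length vs) y vs - D (length vs) x vs - D (Suc (length vs)) x ((y - x) # vs))
        \<le> e * norm (y - x)" if "norm (y - x) < d" for y
      using d[OF that] by (force intro: order_trans)
    then show "\<exists>d>0. \<forall>y. norm (y - x) < d \<longrightarrow>
        norm (D (length vs) y vs - D (length vs) x vs - D (Suc (length vs)) x ((y - x) # vs))
          \<le> e * norm (y - x)"
      using \<open>0 < d\<close> by blast
  qed
  moreover have "\<exists>r>0. \<exists>B\<ge>0. \<forall>x\<in>K. \<forall>y\<in>ball x r. \<forall>vs. length vs = k \<longrightarrow>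
        norm (D k y vs) \<le> B * prod_list (map norm vs)" if K: "compact K" for k K
  proof -
    have pos: "0 \<le> prod_list (map norm vs)" for vs :: "'a list"
      by (induction vs) auto
    define P where "P y B \<longleftrightarrow> (\<forall>vs. length vs = k \<longrightarrow> norm (D k y vs) \<le> B * prod_list (map norm vs))"
      for y and B :: real
    \<comment> \<open>Tolerance \<open>1\<close> in the expansion is enough for a bound on the ball
      of radius \<open>d\<close>.\<close>
    have "\<exists>r>0. \<exists>B. \<forall>y\<in>ball x r. P y B" for x
    proof -
      obtain B where B: "\<And>vs. length vs = k \<Longrightarrow> norm (D k x vs) \<le> B * prod_list (map norm vs)" "0 \<le> B"
        using bdd by metis
      obtain B' where B': "\<And>vs. length vs = Suc k \<Longrightarrow> norm (D (Suc k) x vs) \<le> B' * prod_list (map norm vs)"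
          "0 \<le> B'"
        using bdd by metis
      obtain d where d: "0 < d" "\<And>h vs. norm h < d \<Longrightarrow> length vs = k \<Longrightarrow>
         norm (D k (x + h) vs - D k x vs - D (Suc k) x (h # vs)) \<le> 1 * norm h * prod_list (map norm vs)"
        using der[of 1 k x] by auto
      have "norm (D k y vs) \<le> (B + B' * d + d) * prod_list (map norm vs)"
        if y: "y \<in> ball x d" and vs: "length vs = k" for y vs
      proof -
        define h where "h = y - x"
        define q where "q = prod_list (map norm vs)"
        have h: "norm h < d" "y = x + h"
          using y by (auto simp: h_def dist_norm norm_minus_commute)
        have "norm (D k (x + h) vs - D k x vs - D (Suc k) x (h # vs)) \<le> norm h * q"
          using d(2)[OF h(1) vs] by (simp add: q_def)
        also have "\<dots> \<le> d * q"
          using h pos[of vs] by (intro mult_right_mono) (auto simp: q_def)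
        finally have 1: "norm (D k (x + h) vs - D k x vs - D (Suc k) x (h # vs)) \<le> d * q" .
        have "norm (D (Suc k) x (h # vs)) \<le> B' * norm h * q"
          using B'(1)[of "h # vs"] vs by (simp add: q_def)
        also have "\<dots> \<le> B' * d * q"
          using h pos[of vs] B' by (intro mult_right_mono mult_left_mono) (auto simp: q_def)
        finally have 2: "norm (D (Suc k) x (h # vs)) \<le> B' * d * q" .
        have "norm (D k (x + h) vs) \<le> norm (D k (x + h) vs - D k x vs - D (Suc k) x (h # vs))
            + norm (D k x vs) + norm (D (Suc k) x (h # vs))"
          by norm
        also have "\<dots> \<le> d * q + B * q + B' * d * q"
          using 1 2 B(1)[OF vs] by (simp add: q_def)
        finally show ?thesis
          by (simp add: h q_def algebra_simps)
      qed
      then show ?thesis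
        using d unfolding P_def by blast
    qed
    moreover have "P y C" if "P y B" "B \<le> C" for y B C
      using that pos mult_right_mono[OF \<open>B \<le> C\<close> pos] unfolding P_def by (blast intro: order_trans)
    ultimately obtain r B where "0 < r" "0 \<le> B" "\<And>x y. x \<in> K \<Longrightarrow> y \<in> ball x r \<Longrightarrow> P y B"
      using compact_locally_bounded[OF K, of P] by blast
    then show ?thesis
      unfolding P_def by blast
  qed
  ultimately show ?thesis
    by (rule that[of D, OF D0])
qed

text \<open>Only two orders of differentiation enter the argument. The local Lipschitz bound for
  \<open>g'\<close> follows from the bound on \<open>D 2\<close> near \<open>K\<close> by the mean
  value inequality, applied for each fixed \<open>w\<close> on a ball, which is convex.\<close>

lemma smooth_differential:
  fixes g :: "'a::real_normed_vector \<Rightarrow> 'b::real_normed_vector"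
  assumes "smooth g"
  obtains g' where "\<And>x. (g has_derivative g' x) (at x)"
    "\<And>K. compact K \<Longrightarrow> \<exists>B\<ge>0. \<forall>x\<in>K. \<forall>w. norm (g' x w) \<le> B * norm w"
    "\<And>K. compact K \<Longrightarrow> \<exists>r>0. \<exists>B\<ge>0. \<forall>x\<in>K. \<forall>y\<in>ball x r. \<forall>z\<in>ball x r. \<forall>w.
        norm (g' y w - g' z w) \<le> B * norm (y - z) * norm w"
proof -
  obtain D where D: "\<And>x. D 0 x [] = g x"
    "\<And>x vs. ((\<lambda>x. D (length vs) x vs) has_derivative (\<lambda>h. D (Suc (length vs)) x (h # vs))) (at x)"
    "\<And>k K. compact K \<Longrightarrow> \<exists>r>0. \<exists>B\<ge>0. \<forall>x\<in>K. \<forall>y\<in>ball x r. \<forall>vs. length vs = k \<longrightarrow>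
        norm (D k y vs) \<le> B * prod_list (map norm vs)"
    using smooth_derivatives[OF assms] by blast
  have "(g has_derivative (\<lambda>h. D 1 x [h])) (at x)" for x
    using D(2)[of "[]" x] by (simp add: D(1))
  moreover have "\<exists>B\<ge>0. \<forall>x\<in>K. \<forall>w. norm (D 1 x [w]) \<le> B * norm w" if K: "compact K" for K
  proof -
    obtain r B where "0 < r" "0 \<le> B" and B: "\<And>x y vs. x \<in> K \<Longrightarrow> y \<in> ball x r \<Longrightarrow> length vs = 1 \<Longrightarrow>
        norm (D 1 y vs) \<le> B * prod_list (map norm vs)"
      using D(3)[OF K, of 1] by blast
    then show ?thesis
      using B[of x x "[w]" for x w] by (intro exI[of _ B]) auto
  qed
  moreover have "\<exists>r>0. \<exists>B\<ge>0. \<forall>x\<in>K. \<forall>y\<in>ball x r. \<forall>z\<in>ball x r. \<forall>w.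
        norm (D 1 y [w] - D 1 z [w]) \<le> B * norm (y - z) * norm w" if K: "compact K" for K
  proof -
    obtain r B where "0 < r" "0 \<le> B" and B: "\<And>x y vs. x \<in> K \<Longrightarrow> y \<in> ball x r \<Longrightarrow> length vs = 2 \<Longrightarrow>
        norm (D 2 y vs) \<le> B * prod_list (map norm vs)"
      using D(3)[OF K, of 2] by blast
    have "norm (D 1 y [w] - D 1 z [w]) \<le> (B * norm w) * norm (y - z)"
      if "x \<in> K" "y \<in> ball x r" "z \<in> ball x r" for x y z w
    proof (rule differentiable_bound[OF convex_ball _ _ that(2,3)])
      fix q assume q: "q \<in> ball x r"
      have "((\<lambda>x. D 1 x [w]) has_derivative (\<lambda>h. D 2 q [h, w])) (at q)"
        using D(2)[of "[w]" q] by (simp add: numeral_2_eq_2)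
      then show "((\<lambda>x. D 1 x [w]) has_derivative (\<lambda>h. D 2 q [h, w])) (at q within ball x r)"
        by (rule has_derivative_at_withinI)
      show "onorm (\<lambda>h. D 2 q [h, w]) \<le> B * norm w"
        using B[OF \<open>x \<in> K\<close> q, of "[h, w]" for h] \<open>0 \<le> B\<close>
        by (intro onorm_bound) (auto simp: mult_ac)
    qed
    then show ?thesis
      using \<open>0 < r\<close> \<open>0 \<le> B\<close> by (intro exI[of _ r] conjI exI[of _ B]) (auto simp: mult_ac)
  qed
  ultimately show ?thesis
    by (rule that)
qed

section \<open>Solutions on compact intervals\<close>

lemma solves_ode_continuous:
  assumes "smooth f" "solves_ode f u J" "{a..b} \<subseteq> J"
  shows "continuous_on {a..b} u" "continuous_on {a..b} (\<lambda>s. f (u s))"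
proof -
  have "(u has_derivative (\<lambda>r. r *\<^sub>R f (u s))) (at s)" if "s \<in> {a..b}" for s
    using assms that unfolding solves_ode_def has_vector_derivative_def by blast
  then show cu: "continuous_on {a..b} u"
    using has_derivative_continuous by (fastforce intro!: continuous_at_imp_continuous_on)
  obtain f' where f': "\<And>x. (f has_derivative f' x) (at x)"
    using smooth_differential[OF \<open>smooth f\<close>] by metis
  show "continuous_on {a..b} (\<lambda>s. f (u s))"
  proof (rule continuous_on_compose2[OF _ cu])
    show "continuous_on UNIV f"
      using f' has_derivative_continuous by (fastforce intro!: continuous_at_imp_continuous_on)
  qed auto
qed

text \<open>A Taylor estimate that avoids a second derivative of \<open>u\<close>: along the
  solution \<open>f\<close> is Lipschitz, because the derivative of \<open>f (u r)\<close> in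
  \<open>r\<close> is bounded on the interval, and this Lipschitz bound enters a second mean value
  inequality.\<close>

lemma solves_ode_quadratic_remainder:
  assumes "smooth f" "solves_ode f u J" "{a..b} \<subseteq> J"
  obtains M where "0 \<le> M"
    "\<And>s s'. s \<in> {a..b} \<Longrightarrow> s' \<in> {a..b} \<Longrightarrow> norm (u s - u s' - (s - s') *\<^sub>R f (u s')) \<le> M * (s - s')\<^sup>2"
proof -
  obtain f' where f': "\<And>x. (f has_derivative f' x) (at x)"
    "\<And>K. compact K \<Longrightarrow> \<exists>B\<ge>0. \<forall>x\<in>K. \<forall>w. norm (f' x w) \<le> B * norm w"
    using smooth_differential[OF \<open>smooth f\<close>] by metis
  have u': "(u has_derivative (\<lambda>r. r *\<^sub>R f (u s))) (at s)" if "s \<in> {a..b}" for s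
    using assms that unfolding solves_ode_def has_vector_derivative_def by blast
  have "compact (u ` {a..b})"
    using solves_ode_continuous(1)[OF assms]
    by (intro compact_continuous_image) auto
  then obtain B where B: "0 \<le> B" "\<And>s w. s \<in> {a..b} \<Longrightarrow> norm (f' (u s) w) \<le> B * norm w"
    using f'(2)[of "u ` {a..b}"] by (metis imageI)
  have "bounded ((\<lambda>s. f (u s)) ` {a..b})"
    using solves_ode_continuous(2)[OF assms]
    by (intro compact_imp_bounded compact_continuous_image) auto
  then obtain F where F: "0 < F" "\<And>s. s \<in> {a..b} \<Longrightarrow> norm (f (u s)) \<le> F"
    unfolding bounded_pos by blast
  have lip: "norm (f (u s) - f (u s')) \<le> B * F * norm (s - s')" if "s \<in> {a..b}" "s' \<in> {a..b}" for s s'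
  proof (rule differentiable_bound[OF convex_real_interval(5) _ _ that])
    fix r assume r: "r \<in> {a..b}"
    show "((\<lambda>s. f (u s)) has_derivative (\<lambda>h. f' (u r) (h *\<^sub>R f (u r)))) (at r within {a..b})"
      by (rule has_derivative_at_withinI, rule has_derivative_compose[OF u'[OF r] f'(1)])
    have "norm (f' (u r) (h *\<^sub>R f (u r))) \<le> B * F * norm h" for h
    proof -
      have "norm (f' (u r) (h *\<^sub>R f (u r))) \<le> B * (norm h * norm (f (u r)))"
        using B(2)[OF r, of "h *\<^sub>R f (u r)"] by simp
      also have "\<dots> \<le> B * (norm h * F)"
        using B F(2)[OF r] by (intro mult_left_mono) auto
      finally show ?thesis by (simp add: mult_ac)
    qed
    then show "onorm (\<lambda>h. f' (u r) (h *\<^sub>R f (u r))) \<le> B * F"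
      using B F by (intro onorm_bound) auto
  qed
  have "norm (u s - u s' - (s - s') *\<^sub>R f (u s')) \<le> (B * F) * (s - s')\<^sup>2"
    if s: "s \<in> {a..b}" "s' \<in> {a..b}" for s s'
  proof -
    \<comment> \<open>Mean value inequality for \<open>u r\<close> minus \<open>r\<close> times
      \<open>f (u s')\<close>. Its derivative \<open>f (u r) - f (u s')\<close> is at most
      \<open>B * F * \<bar>s - s'\<bar>\<close> on the segment, which supplies the second factor of
      the square.\<close>
    have "norm ((u s - s *\<^sub>R f (u s')) - (u s' - s' *\<^sub>R f (u s'))) \<le> (B * F * \<bar>s - s'\<bar>) * norm (s - s')"
    proof (rule differentiable_bound[OF convex_closed_segment])
      fix r assume "r \<in> closed_segment s s'"
      then have r: "r \<in> {a..b}" "\<bar>r - s'\<bar> \<le> \<bar>s - s'\<bar>"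
        using s by (cases "s \<le> s'"; simp add: closed_segment_eq_real_ivl)+
      show "((\<lambda>r. u r - r *\<^sub>R f (u s')) has_derivative (\<lambda>h. h *\<^sub>R f (u r) - h *\<^sub>R f (u s')))
          (at r within closed_segment s s')"
        by (rule has_derivative_at_withinI, rule has_derivative_diff[OF u'[OF r(1)]])
          (auto intro!: derivative_eq_intros)
      have "norm (f (u r) - f (u s')) \<le> B * F * \<bar>s - s'\<bar>"
        using lip[OF r(1) s(2)] mult_left_mono[OF r(2), of "B * F"] B F by simp
      then have "norm (h *\<^sub>R f (u r) - h *\<^sub>R f (u s')) \<le> B * F * \<bar>s - s'\<bar> * norm h" for h
        by (metis abs_ge_zero mult.commute mult_left_mono norm_scaleR real_norm_def scaleR_diff_right)
      then show "onorm (\<lambda>h. h *\<^sub>R f (u r) - h *\<^sub>R f (u s')) \<le> B * F * \<bar>s - s'\<bar>"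
        using B F by (intro onorm_bound) auto
    qed auto
    then show ?thesis
      by (simp add: power2_eq_square algebra_simps abs_mult_self_eq)
  qed
  then show ?thesis
    using that[of "B * F"] B F by simp
qed

section \<open>Roots and asymptotic bounds\<close>

text \<open>On the ball \<open>g\<close> differs from its linearisation with slope
  \<open>g' x\<close> by at most \<open>\<mu>\<close> times the distance, while the slope has
  modulus at least \<open>2 * \<mu>\<close>. Hence \<open>g\<close> expands distances by a factor of
  at least \<open>\<mu>\<close>, which gives injectivity and locates the root. At the two ends the
  linear part outweighs \<open>g x\<close> and the error together, which forces a sign
  change.\<close>

lemma root_near_approximate_root:
  fixes g g' :: "real \<Rightarrow> real"
  assumes "0 < \<mu>" "0 < \<rho>"
    and der: "\<And>s. s \<in> cball x \<rho> \<Longrightarrow> (g has_field_derivative g' s) (at s)"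
    and close: "\<And>s. s \<in> cball x \<rho> \<Longrightarrow> \<bar>g' s - g' x\<bar> \<le> \<mu>"
    and slope: "2 * \<mu> \<le> \<bar>g' x\<bar>" and small: "\<bar>g x\<bar> \<le> \<mu> * \<rho>"
  shows "\<exists>z\<in>cball x \<rho>. g z = 0 \<and> \<bar>z - x\<bar> \<le> \<bar>g x\<bar> / \<mu>" and "inj_on g (cball x \<rho>)"
proof -
  have lin: "\<bar>g s - g s' - g' x * (s - s')\<bar> \<le> \<mu> * \<bar>s - s'\<bar>" if "s \<in> cball x \<rho>" "s' \<in> cball x \<rho>" for s s'
  proof -
    have "norm ((g s - g' x * s) - (g s' - g' x * s')) \<le> \<mu> * norm (s - s')"
    proof (rule field_differentiable_bound[OF convex_cball _ _ that])
      fix r assume r: "r \<in> cball x \<rho>"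
      show "((\<lambda>r. g r - g' x * r) has_field_derivative g' r - g' x) (at r within cball x \<rho>)"
        by (rule has_field_derivative_at_within) (auto intro!: derivative_eq_intros der[OF r])
      show "norm (g' r - g' x) \<le> \<mu>"
        using close[OF r] by simp
    qed
    then show ?thesis
      by (simp add: algebra_simps)
  qed
  have expand: "\<mu> * \<bar>s - s'\<bar> \<le> \<bar>g s - g s'\<bar>" if "s \<in> cball x \<rho>" "s' \<in> cball x \<rho>" for s s'
  proof -
    have "2 * \<mu> * \<bar>s - s'\<bar> \<le> \<bar>g' x * (s - s')\<bar>"
      using slope by (simp add: abs_mult mult_right_mono)
    then show ?thesis
      using lin[OF that] by simp
  qed
  then show "inj_on g (cball x \<rho>)"
    using \<open>0 < \<mu>\<close> by (intro inj_onI) (fastforce simp: mult_le_0_iff)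
  \<comment> \<open>Multiplication by the sign of the slope reduces both cases to a positive
    slope.\<close>
  define \<sigma> where "\<sigma> = sgn (g' x)"
  have \<sigma>: "\<sigma> * g' x = \<bar>g' x\<bar>" "\<bar>\<sigma>\<bar> = 1"
    using slope \<open>0 < \<mu>\<close> by (auto simp: \<sigma>_def sgn_if)
  have ends: "x + \<rho> \<in> cball x \<rho>" "x - \<rho> \<in> cball x \<rho>" "x \<in> cball x \<rho>"
    using \<open>0 < \<rho>\<close> by (auto simp: dist_real_def)
  have sg: "\<bar>\<sigma> * y\<bar> = \<bar>y\<bar>" for y
    using \<sigma>(2) by (simp add: abs_mult)
  have big: "2 * \<mu> * \<rho> \<le> \<bar>g' x\<bar> * \<rho>"
    using slope \<open>0 < \<rho>\<close> by simp
  have "\<bar>\<sigma> * (g (x + \<rho>) - g x - g' x * \<rho>)\<bar> \<le> \<mu> * \<rho>" "\<bar>\<sigma> * g x\<bar> \<le> \<mu> * \<rho>"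
    using lin[OF ends(1,3)] small \<open>0 < \<rho>\<close> by (simp_all only: sg) simp
  moreover have "\<sigma> * (g (x + \<rho>) - g x - g' x * \<rho>) = \<sigma> * g (x + \<rho>) - \<sigma> * g x - \<bar>g' x\<bar> * \<rho>"
    by (simp add: algebra_simps flip: \<sigma>(1))
  ultimately have hi: "0 \<le> \<sigma> * g (x + \<rho>)"
    using big by linarith
  have "\<bar>\<sigma> * (g (x - \<rho>) - g x + g' x * \<rho>)\<bar> \<le> \<mu> * \<rho>" "\<bar>\<sigma> * g x\<bar> \<le> \<mu> * \<rho>"
    using lin[OF ends(2,3)] small \<open>0 < \<rho>\<close> by (simp_all only: sg) simp
  moreover have "\<sigma> * (g (x - \<rho>) - g x + g' x * \<rho>) = \<sigma> * g (x - \<rho>) - \<sigma> * g x + \<bar>g' x\<bar> * \<rho>"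
    by (simp add: algebra_simps flip: \<sigma>(1))
  ultimately have lo: "\<sigma> * g (x - \<rho>) \<le> 0"
    using big by linarith
  have "continuous_on {x - \<rho>..x + \<rho>} (\<lambda>s. \<sigma> * g s)"
    using der by (intro continuous_intros continuous_at_imp_continuous_on ballI DERIV_isCont[OF der])
      (auto simp: dist_real_def)
  then obtain z where z: "x - \<rho> \<le> z" "z \<le> x + \<rho>" "\<sigma> * g z = 0"
    using IVT'[of "\<lambda>s. \<sigma> * g s" "x - \<rho>" 0 "x + \<rho>"] lo hi \<open>0 < \<rho>\<close> by auto
  then have "g z = 0" "z \<in> cball x \<rho>"
    using \<sigma>(2) by (auto simp: dist_real_def)
  moreover from this have "\<bar>z - x\<bar> \<le> \<bar>g x\<bar> / \<mu>"
    using expand[of z x] ends \<open>0 < \<mu>\<close> by (simp add: field_simps)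
  ultimately show "\<exists>z\<in>cball x \<rho>. g z = 0 \<and> \<bar>z - x\<bar> \<le> \<bar>g x\<bar> / \<mu>"
    by blast
qed

lemma bigo_at_right_powerE:
  fixes g :: "real \<Rightarrow> real"
  assumes "g \<in> O[at_right 0](\<lambda>h. h ^ q)"
  obtains C where "0 < C" "\<forall>\<^sub>F h in at_right 0. \<bar>g h\<bar> \<le> C * h ^ q"
proof -
  obtain C where "0 < C" and C: "\<forall>\<^sub>F h in at_right 0. norm (g h) \<le> C * norm (h ^ q)"
    using assms by (elim landau_o.bigE)
  have "\<forall>\<^sub>F h in at_right 0. \<bar>g h\<bar> \<le> C * h ^ q"
    using C eventually_at_right_less[of 0] by eventually_elim auto
  then show ?thesis
    using that \<open>0 < C\<close> by blast
qed

lemma eventually_at_right_0_le: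
  fixes e :: real
  assumes "0 < e"
  shows "\<forall>\<^sub>F h in at_right 0. h \<le> e"
  using eventually_at_right_real[OF assms] by eventually_elim auto

section \<open>Old values and previous times\<close>

text \<open>Since the weights sum to one, a constant can be moved into the average. This turns the
  increments of time and value over a step into averages of increments from single previous
  items.\<close>

lemma old_average_linear:
  assumes "(\<Sum>i<m. \<nu> i) = 1"
  shows "x - old_average m \<nu> y = old_average m \<nu> (\<lambda>j. x - y j)"
    and "old_average m \<nu> y - old_average m \<nu> z = old_average m \<nu> (\<lambda>j. y j - z j)"
    and "old_average m \<nu> c *\<^sub>R w = old_average m \<nu> (\<lambda>j. c j *\<^sub>R w)"
  using assms
  by (simp_all add: old_average_def scaleR_diff_right sum_subtractf scaleR_sum_left flip: scaleR_sum_left)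

lemma norm_old_average_le:
  fixes x :: "nat \<Rightarrow> 'b::real_normed_vector"
  assumes "\<forall>i<m. 0 \<le> \<nu> i" "(\<Sum>i<m. \<nu> i) = 1" "\<And>j. j \<in> {1..m} \<Longrightarrow> norm (x j) \<le> B"
  shows "norm (old_average m \<nu> x) \<le> B"
proof -
  have "norm (old_average m \<nu> x) \<le> (\<Sum>i<m. \<nu> i * B)"
    unfolding old_average_def using assms by (intro sum_norm_le) (auto intro!: mult_left_mono)
  then show ?thesis
    using assms(2) by (simp flip: sum_distrib_right)
qed

lemma old_average_ge:
  fixes x :: "nat \<Rightarrow> real"
  assumes "\<forall>i<m. 0 \<le> \<nu> i" "(\<Sum>i<m. \<nu> i) = 1" "\<And>j. j \<in> {1..m} \<Longrightarrow> B \<le> x j"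
  shows "B \<le> old_average m \<nu> x"
proof -
  have "(\<Sum>i<m. \<nu> i * B) \<le> old_average m \<nu> x"
    unfolding old_average_def using assms by (intro sum_mono) (auto intro!: mult_left_mono)
  then show ?thesis
    using assms(2) by (simp flip: sum_distrib_right)
qed

text \<open>Recentres the relaxation at the new value, so that smallness of \<open>s - 1\<close>
  becomes visible.\<close>

lemma relax_eq_new: "relax s old new = new + (s - 1) *\<^sub>R (new - old)"
  by (simp add: relax_def algebra_simps)

text \<open>The old values reach back \<open>m\<close> steps and the method \<open>k\<close> steps;
  the order of the method is invoked on the first \<open>k\<close> items only.\<close>

lemma previous_times_mono:
  assumes "previous_times J N t" "k \<le> N"
  shows "previous_times J k t"
proof -
  have sub: "{1..k} \<subseteq> {1..N}" "{1..<k} \<subseteq> {1..<N}"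
    using assms(2) by auto
  obtain a b where "{a..b} \<subseteq> J" and ab: "\<forall>\<^sub>F h in at_right 0. \<forall>j\<in>{1..N}. t h j \<in> {a..b}"
    and dec: "\<forall>\<^sub>F h in at_right 0. \<forall>j\<in>{1..<N}. t h (Suc j) < t h j"
    and gap: "\<forall>j\<in>{1..<N}. (\<lambda>h. t h j - t h (Suc j)) \<in> O[at_right 0](\<lambda>h. h)"
    using assms(1) unfolding previous_times_def by blast
  have "\<forall>\<^sub>F h in at_right 0. \<forall>j\<in>{1..k}. t h j \<in> {a..b}"
    using ab by eventually_elim (use sub in blast)
  moreover have "\<forall>\<^sub>F h in at_right 0. \<forall>j\<in>{1..<k}. t h (Suc j) < t h j"
    using dec by eventually_elim (use sub in blast)
  moreover have "\<forall>j\<in>{1..<k}. (\<lambda>h. t h j - t h (Suc j)) \<in> O[at_right 0](\<lambda>h. h)"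
    using gap sub by blast
  ultimately show ?thesis
    using \<open>{a..b} \<subseteq> J\<close> unfolding previous_times_def by blast
qed

lemma accurate_values_mono: "accurate_values p N u t v \<Longrightarrow> k \<le> N \<Longrightarrow> accurate_values p k u t v"
  unfolding accurate_values_def by auto

text \<open>The gaps telescope, and the strict ordering of the times gives the sign.\<close>

lemma previous_times_spread:
  assumes "previous_times J N t"
  obtains C where "0 < C" "\<forall>\<^sub>F h in at_right 0. \<forall>j\<in>{1..N}. 0 \<le> t h 1 - t h j \<and> t h 1 - t h j \<le> C * h"
proof -
  have dec: "\<forall>\<^sub>F h in at_right 0. \<forall>j\<in>{1..<N}. t h (Suc j) < t h j"
    and gap: "\<And>j. j \<in> {1..<N} \<Longrightarrow> (\<lambda>h. t h j - t h (Suc j)) \<in> O[at_right 0](\<lambda>h. h)"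
    using assms unfolding previous_times_def by auto
  have "1 \<le> j \<longrightarrow> j \<le> N \<longrightarrow> (\<lambda>h. t h 1 - t h j) \<in> O[at_right 0](\<lambda>h. h)" for j
  proof (induction j)
    case (Suc j)
    show ?case
    proof (cases "j = 0")
      case False
      have "(\<lambda>h. (t h 1 - t h j) + (t h j - t h (Suc j))) \<in> O[at_right 0](\<lambda>h. h)"
        if "Suc j \<le> N"
        using Suc gap[of j] that False by (intro sum_in_bigo(1)) auto
      then show ?thesis by simp
    qed simp
  qed simp
  \<comment> \<open>Summing over \<open>j\<close> yields one constant and one range of
    \<open>h\<close> for all indices.\<close>
  then have "(\<lambda>h. \<Sum>j\<in>{1..N}. \<bar>t h 1 - t h j\<bar>) \<in> O[at_right 0](\<lambda>h. h ^ 1)"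
    by (intro big_sum_in_bigo) auto
  then obtain C where "0 < C" and C: "\<forall>\<^sub>F h in at_right 0. \<bar>\<Sum>j\<in>{1..N}. \<bar>t h 1 - t h j\<bar>\<bar> \<le> C * h ^ 1"
    by (rule bigo_at_right_powerE)
  have "\<forall>\<^sub>F h in at_right 0. \<forall>j\<in>{1..N}. 0 \<le> t h 1 - t h j \<and> t h 1 - t h j \<le> C * h"
    using C dec
  proof eventually_elim
    case (elim h)
    have "t h j \<le> t h 1" if "1 \<le> j" "j \<le> N" for j
      using that
    proof (induction j rule: dec_induct)
      case (step j)
      then show ?case
        using bspec[OF elim(2), of j] by auto
    qed simp
    moreover have "\<bar>t h 1 - t h j\<bar> \<le> C * h" if "j \<in> {1..N}" for j
      using member_le_sum[of j "{1..N}" "\<lambda>j. \<bar>t h 1 - t h j\<bar>"] that elim(1) by (simp add: sum_nonneg)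
    ultimately show ?case
      by fastforce
  qed
  then show ?thesis
    using that \<open>0 < C\<close> by blast
qed

lemma accurate_values_uniform:
  assumes "accurate_values p N u t v"
  obtains C where "0 < C" "\<forall>\<^sub>F h in at_right 0. \<forall>j\<in>{1..N}. norm (v h j - u (t h j)) \<le> C * h ^ (p + 1)"
proof -
  have "(\<lambda>h. \<Sum>j\<in>{1..N}. norm (v h j - u (t h j))) \<in> O[at_right 0](\<lambda>h. h ^ (p + 1))"
    using assms unfolding accurate_values_def by (intro big_sum_in_bigo) auto
  then obtain C where "0 < C" and
    C: "\<forall>\<^sub>F h in at_right 0. \<bar>\<Sum>j\<in>{1..N}. norm (v h j - u (t h j))\<bar> \<le> C * h ^ (p + 1)"
    by (rule bigo_at_right_powerE)
  have "\<forall>\<^sub>F h in at_right 0. \<forall>j\<in>{1..N}. norm (v h j - u (t h j)) \<le> C * h ^ (p + 1)"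
    using C
  proof eventually_elim
    case (elim h)
    then show ?case
      using member_le_sum[of _ "{1..N}" "\<lambda>j. norm (v h j - u (t h j))"] by (fastforce simp: sum_nonneg)
  qed
  then show ?thesis
    using that \<open>0 < C\<close> by blast
qed

text \<open>Provides a margin around the previous times, since the new and the relaxed time may lie
  outside their interval.\<close>

lemma open_interval_enlarge:
  fixes J :: "real set"
  assumes "open J" "is_interval J" "{a..b} \<subseteq> J" "a \<le> b"
  obtains e where "0 < e" "{a - e..b + e} \<subseteq> J"
proof -
  have "a \<in> J" "b \<in> J"
    using assms by auto
  then obtain e e' where e: "0 < e" "cball a e \<subseteq> J" "0 < e'" "cball b e' \<subseteq> J"
    using \<open>open J\<close> open_contains_cball by metis
  have "a - min e e' \<in> J" "b + min e e' \<in> J"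
    using e by (auto simp: subset_iff dist_real_def)
  then have "{a - min e e'..b + min e e'} \<subseteq> J"
    using \<open>is_interval J\<close> unfolding is_interval_1 by (meson atLeastAtMost_iff subsetI)
  then show ?thesis
    using that[of "min e e'"] e by simp
qed

section \<open>Relaxation\<close>

text \<open>The increment is an average of increments from the single previous items, each expanded
  about the new time \<open>s'\<close>. The three constants stem from the errors of the old values,
  the error of the new value and the Taylor remainder over a time span of at most
  \<open>T * h\<close>.\<close>

lemma increment_expansion:
  assumes \<nu>: "\<forall>i<m. 0 \<le> \<nu> i" "(\<Sum>i<m. \<nu> i) = 1"
    and "0 \<le> M"
    and rem: "\<And>j. j \<in> {1..m} \<Longrightarrow> norm (u (s j) - u s' - (s j - s') *\<^sub>R w) \<le> M * (s j - s')\<^sup>2"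
    and spread: "\<And>j. j \<in> {1..m} \<Longrightarrow> \<bar>s j - s'\<bar> \<le> T * h"
    and old: "\<And>j. j \<in> {1..m} \<Longrightarrow> norm (y j - u (s j)) \<le> A * h\<^sup>2"
    and new: "norm (y' - u s') \<le> B * h\<^sup>2"
  shows "norm ((y' - old_average m \<nu> y) - (s' - old_average m \<nu> s) *\<^sub>R w) \<le> (A + B + M * T\<^sup>2) * h\<^sup>2"
proof -
  have "(y' - old_average m \<nu> y) - (s' - old_average m \<nu> s) *\<^sub>R w
      = old_average m \<nu> (\<lambda>j. (y' - y j) - (s' - s j) *\<^sub>R w)"
    unfolding old_average_linear(1)[OF \<nu>(2), where x = y']
      old_average_linear(1)[OF \<nu>(2), where x = s'] old_average_linear(2,3)[OF \<nu>(2)] ..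
  also have "norm \<dots> \<le> (A + B + M * T\<^sup>2) * h\<^sup>2"
  proof (rule norm_old_average_le[OF \<nu>])
    fix j assume j: "j \<in> {1..m}"
    have "(s j - s')\<^sup>2 \<le> (T * h)\<^sup>2"
      using spread[OF j] by (metis abs_ge_zero power2_abs power_mono)
    then have "M * (s j - s')\<^sup>2 \<le> M * T\<^sup>2 * h\<^sup>2"
      using mult_left_mono[OF _ \<open>0 \<le> M\<close>] by (simp add: power_mult_distrib mult.assoc)
    moreover have "(y' - y j) - (s' - s j) *\<^sub>R w
        = (y' - u s') - (y j - u (s j)) - (u (s j) - u s' - (s j - s') *\<^sub>R w)"
      by (simp add: algebra_simps)
    moreover have "norm ((y' - u s') - (y j - u (s j)) - (u (s j) - u s' - (s j - s') *\<^sub>R w))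
        \<le> norm (y' - u s') + norm (y j - u (s j)) + norm (u (s j) - u s' - (s j - s') *\<^sub>R w)"
      by (meson add_right_mono norm_triangle_ineq4 order_trans)
    ultimately show "norm ((y' - y j) - (s' - s j) *\<^sub>R w) \<le> (A + B + M * T\<^sup>2) * h\<^sup>2"
      using rem[OF j] old[OF j] new by (simp add: algebra_simps)
  qed
  finally show ?thesis .
qed

text \<open>The root lemma is applied for each small \<open>h\<close> with
  \<open>\<mu> = q * h\<^sup>2\<close> and a radius independent of \<open>h\<close>. The derivative
  of the residual at \<open>1\<close> is the slope term minus
  \<open>\<eta>_new h - \<eta>_old h\<close>. Divided by the norm of the increment, both may be of
  order \<open>h\<close>; \<open>gap\<close> prevents them from cancelling to leading order.\<close>

lemma relaxation_parameter_exists_unique: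
  fixes \<eta> :: "'a::real_normed_vector \<Rightarrow> real" and u_old u_new :: "real \<Rightarrow> 'a"
  assumes "2 \<le> p"
    and der: "\<And>x. (\<eta> has_derivative \<eta>' x) (at x)"
    and "0 < r" "0 \<le> L"
    and lip: "\<forall>\<^sub>F h in at_right 0. \<forall>y\<in>ball (u_new h) r. \<forall>w.
        \<bar>\<eta>' y w - \<eta>' (u_new h) w\<bar> \<le> L * norm (y - u_new h) * norm w"
    and "0 < d" "0 < D"
    and lower: "\<forall>\<^sub>F h in at_right 0. d * h \<le> norm (u_new h - u_old h)"
    and upper: "\<forall>\<^sub>F h in at_right 0. norm (u_new h - u_old h) \<le> D * h"
    and estimate: "(\<lambda>h. \<eta>_new h - \<eta> (u_new h)) \<in> O[at_right 0](\<lambda>h. h ^ (p + 1))"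
    and slope: "(\<lambda>h. \<eta>' (u_new h) (u_new h - u_old h) / norm (u_new h - u_old h) - c * h)
        \<in> O[at_right 0](\<lambda>h. h ^ 2)"
    and "0 < \<kappa>"
    and gap: "\<forall>\<^sub>F h in at_right 0. \<kappa> * h \<le> \<bar>c * h - (\<eta>_new h - \<eta>_old h) / norm (u_new h - u_old h)\<bar>"
  shows "\<exists>\<gamma>. relaxation_parameter p \<eta> u_old u_new \<eta>_old \<eta>_new \<gamma> \<and>
    (\<forall>\<gamma>'. relaxation_parameter p \<eta> u_old u_new \<eta>_old \<eta>_new \<gamma>' \<longrightarrow>
      (\<forall>\<^sub>F h in at_right 0. \<gamma>' h = \<gamma> h))"
proof -
  obtain B where "0 < B" and B: "\<forall>\<^sub>F h in at_right 0. \<bar>\<eta>_new h - \<eta> (u_new h)\<bar> \<le> B * h ^ (p + 1)"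
    using estimate by (rule bigo_at_right_powerE)
  obtain E where "0 < E" and E: "\<forall>\<^sub>F h in at_right 0.
      \<bar>\<eta>' (u_new h) (u_new h - u_old h) / norm (u_new h - u_old h) - c * h\<bar> \<le> E * h\<^sup>2"
    using slope by (rule bigo_at_right_powerE)
  \<comment> \<open>Of \<open>d * \<kappa>\<close>, one factor of two is lost to the error in the
    slope condition, the other to the requirement that the slope be twice the variation.\<close>
  define q where "q = d * \<kappa> / 4"
  \<comment> \<open>The cap \<open>1\<close> keeps relaxed points within \<open>D * h\<close> of the
    new value, hence in the Lipschitz ball. The other bound makes the variation of the derivative at
    most \<open>q * h\<^sup>2\<close>; adding \<open>1\<close> avoids a zero denominator.\<close>
  define \<rho> where "\<rho> = min 1 (q / (L * D\<^sup>2 + 1))"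
  have "0 < q"
    using \<open>0 < d\<close> \<open>0 < \<kappa>\<close> by (simp add: q_def)
  have nn: "0 \<le> L * D\<^sup>2"
    using \<open>0 \<le> L\<close> by simp
  have \<rho>: "0 < \<rho>" "\<rho> \<le> 1"
    using \<open>0 < q\<close> nn by (auto simp: \<rho>_def)
  have "L * D\<^sup>2 * \<rho> \<le> L * D\<^sup>2 * (q / (L * D\<^sup>2 + 1))"
    using nn by (intro mult_left_mono) (auto simp: \<rho>_def)
  also have "\<dots> \<le> q"
    using nn \<open>0 < q\<close> by (simp add: divide_simps algebra_simps)
  finally have q: "L * D\<^sup>2 * \<rho> \<le> q" .
  define R where "R h z \<longleftrightarrow> \<eta> (relax z (u_old h) (u_new h)) = relax z (\<eta>_old h) (\<eta>_new h)" for h z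
  \<comment> \<open>Existence and uniqueness hold on one range of \<open>h\<close> that does not
    depend on the candidates, so a competing parameter can later be handled by membership in the
    ball alone.\<close>
  have ev: "\<forall>\<^sub>F h in at_right 0.
      (\<exists>z\<in>cball 1 \<rho>. R h z \<and> \<bar>z - 1\<bar> \<le> B / q * h ^ (p - 1)) \<and>
      (\<forall>y\<in>cball 1 \<rho>. \<forall>z\<in>cball 1 \<rho>. R h y \<longrightarrow> R h z \<longrightarrow> y = z)"
    using lip lower upper B E gap eventually_at_right_less[of 0]
      eventually_at_right_0_le[of 1, OF zero_less_one]
      eventually_at_right_0_le[of "\<kappa> / 2 / E", OF divide_pos_pos[OF half_gt_zero[OF \<open>0 < \<kappa>\<close>] \<open>0 < E\<close>]]
      eventually_at_right_0_le[of "r / 2 / D", OF divide_pos_pos[OF half_gt_zero[OF \<open>0 < r\<close>] \<open>0 < D\<close>]]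
      eventually_at_right_0_le[of "q * \<rho> / B", OF divide_pos_pos[OF mult_pos_pos[OF \<open>0 < q\<close> \<open>0 < \<rho>\<close>] \<open>0 < B\<close>]]
  proof eventually_elim
    case (elim h)
    define x where "x = u_new h - u_old h"
    have h: "0 < h" "h \<le> 1" "E * h \<le> \<kappa> / 2" "D * h < r" "B * h \<le> q * \<rho>"
      using elim(7-11) \<open>0 < E\<close> \<open>0 < D\<close> \<open>0 < B\<close> \<open>0 < r\<close> by (auto simp: field_simps)
    have x: "d * h \<le> norm x" "norm x \<le> D * h" "0 < norm x"
      using elim(2,3) mult_pos_pos[OF \<open>0 < d\<close> h(1)] unfolding x_def by auto
    define g where "g s = \<eta> (relax s (u_old h) (u_new h)) - relax s (\<eta>_old h) (\<eta>_new h)" for s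
    define g' where "g' s = \<eta>' (relax s (u_old h) (u_new h)) x - (\<eta>_new h - \<eta>_old h)" for s
    have R: "R h z \<longleftrightarrow> g z = 0" for z
      by (simp add: R_def g_def)
    have rx: "((\<lambda>s. relax s (u_old h) (u_new h)) has_derivative (\<lambda>e. e *\<^sub>R x)) (at s)" for s
      unfolding relax_def x_def by (auto intro!: derivative_eq_intros)
    have dg: "(g has_field_derivative g' s) (at s)" for s
    proof -
      have "((\<lambda>s. \<eta> (relax s (u_old h) (u_new h))) has_derivative
          (\<lambda>e. \<eta>' (relax s (u_old h) (u_new h)) (e *\<^sub>R x))) (at s)"
        by (rule has_derivative_compose[OF rx der])
      moreover have "(\<lambda>e. \<eta>' (relax s (u_old h) (u_new h)) (e *\<^sub>R x))
          = (*) (\<eta>' (relax s (u_old h) (u_new h)) x)"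
        using linear_scale[OF has_derivative_linear[OF der]] by (auto simp: mult.commute)
      ultimately have "((\<lambda>s. \<eta> (relax s (u_old h) (u_new h))) has_field_derivative
          \<eta>' (relax s (u_old h) (u_new h)) x) (at s)"
        by (simp add: has_field_derivative_def)
      moreover have "((\<lambda>s. relax s (\<eta>_old h) (\<eta>_new h)) has_field_derivative \<eta>_new h - \<eta>_old h) (at s)"
        unfolding relax_def by (auto intro!: derivative_eq_intros)
      ultimately show ?thesis
        unfolding g_def g'_def by (rule DERIV_diff)
    qed
    have close: "\<bar>g' s - g' 1\<bar> \<le> q * h\<^sup>2" if "s \<in> cball 1 \<rho>" for s
    proof -
      have s: "\<bar>s - 1\<bar> \<le> \<rho>"
        using that by (simp add: dist_real_def abs_minus_commute)
      have dx: "norm (relax s (u_old h) (u_new h) - u_new h) = \<bar>s - 1\<bar> * norm x"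
        by (simp add: relax_eq_new x_def)
      also have "\<dots> \<le> 1 * (D * h)"
        using s \<rho> x by (intro mult_mono) auto
      finally have mem: "relax s (u_old h) (u_new h) \<in> ball (u_new h) r"
        using h by (simp add: dist_norm norm_minus_commute)
      have "\<bar>g' s - g' 1\<bar> \<le> L * (\<bar>s - 1\<bar> * norm x) * norm x"
        using elim(1)[rule_format, OF mem, of x] unfolding dx by (simp add: g'_def relax_eq_new[of 1])
      also have "\<dots> \<le> L * (\<rho> * (D * h)) * (D * h)"
        using s \<rho> x \<open>0 \<le> L\<close> h \<open>0 < D\<close> by (intro mult_mono mult_nonneg_nonneg) auto
      also have "\<dots> = L * D\<^sup>2 * \<rho> * h\<^sup>2"
        by (simp add: power2_eq_square)
      also have "\<dots> \<le> q * h\<^sup>2"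
        using q by (intro mult_right_mono) auto
      finally show ?thesis .
    qed
    \<comment> \<open>The slope error \<open>E * h\<^sup>2\<close> uses up at most half of
      \<open>\<kappa> * h\<close>; multiplying by the norm of the increment, at least
      \<open>d * h\<close>, restores the undivided derivative.\<close>
    have steep: "2 * (q * h\<^sup>2) \<le> \<bar>g' 1\<bar>"
    proof -
      have "E * h\<^sup>2 \<le> \<kappa> / 2 * h"
        using mult_right_mono[OF h(3), of h] h(1) by (simp add: power2_eq_square mult.assoc)
      then have "\<kappa> / 2 * h \<le> \<bar>\<eta>' (u_new h) x / norm x - (\<eta>_new h - \<eta>_old h) / norm x\<bar>"
        using elim(5,6) unfolding x_def by linarith
      then have "d * h * (\<kappa> / 2 * h)
          \<le> norm x * \<bar>\<eta>' (u_new h) x / norm x - (\<eta>_new h - \<eta>_old h) / norm x\<bar>"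
        using x h \<open>0 < \<kappa>\<close> by (intro mult_mono) auto
      also have "\<dots> = \<bar>norm x * (\<eta>' (u_new h) x / norm x - (\<eta>_new h - \<eta>_old h) / norm x)\<bar>"
        by (simp add: abs_mult)
      also have "norm x * (\<eta>' (u_new h) x / norm x - (\<eta>_new h - \<eta>_old h) / norm x) = g' 1"
        using x(3) by (simp add: g'_def relax_eq_new[of 1] field_simps)
      finally show ?thesis
        by (simp add: q_def power2_eq_square mult_ac)
    qed
    have "g 1 = \<eta> (u_new h) - \<eta>_new h"
      by (simp add: g_def relax_def)
    then have g1: "\<bar>g 1\<bar> \<le> B * h ^ (p + 1)"
      using elim(4) by (simp add: abs_minus_commute)
    have pp: "h ^ (p + 1) = h ^ (p - 1) * h\<^sup>2"
      using \<open>2 \<le> p\<close> by (simp flip: power_add)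
    \<comment> \<open>Here \<open>p \<ge> 2\<close> enters: the residual at \<open>1\<close> is
      smaller than \<open>h\<^sup>2\<close> by a factor of order \<open>h\<close>, so it fits a ball
      of fixed radius.\<close>
    have "h ^ (p - 1) \<le> h ^ 1"
      using h \<open>2 \<le> p\<close> by (intro power_decreasing) auto
    then have "B * h ^ (p + 1) \<le> B * h * h\<^sup>2"
      unfolding pp using \<open>0 < B\<close> by (simp add: mult.assoc mult_right_mono)
    also have "\<dots> \<le> q * \<rho> * h\<^sup>2"
      using h by (intro mult_right_mono) auto
    finally have small: "\<bar>g 1\<bar> \<le> q * h\<^sup>2 * \<rho>"
      using g1 by (simp add: mult_ac)
    have pos: "0 < q * h\<^sup>2"
      using \<open>0 < q\<close> h by simp
    obtain z where z: "z \<in> cball 1 \<rho>" "g z = 0" "\<bar>z - 1\<bar> \<le> \<bar>g 1\<bar> / (q * h\<^sup>2)"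
      using root_near_approximate_root(1)[OF pos \<rho>(1) dg close steep small] by blast
    have "\<bar>g 1\<bar> / (q * h\<^sup>2) \<le> B * (h ^ (p - 1) * h\<^sup>2) / (q * h\<^sup>2)"
      using g1 pos unfolding pp by (intro divide_right_mono) auto
    also have "\<dots> = B / q * h ^ (p - 1)"
      using h by simp
    finally have "\<bar>z - 1\<bar> \<le> B / q * h ^ (p - 1)"
      using z by linarith
    then show ?case
      using z root_near_approximate_root(2)[OF pos \<rho>(1) dg close steep small]
      unfolding R by (auto simp: inj_on_def)
  qed
  \<comment> \<open>A root is chosen separately for each \<open>h\<close>; for large
    \<open>h\<close> the value is arbitrary, which does not affect the asymptotic claims.\<close>
  define \<gamma> where "\<gamma> h = (SOME z. z \<in> cball 1 \<rho> \<and> R h z \<and> \<bar>z - 1\<bar> \<le> B / q * h ^ (p - 1))" for h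
  have \<gamma>: "\<forall>\<^sub>F h in at_right 0. \<gamma> h \<in> cball 1 \<rho> \<and> R h (\<gamma> h) \<and> \<bar>\<gamma> h - 1\<bar> \<le> B / q * h ^ (p - 1)"
    using ev
  proof eventually_elim
    case (elim h)
    then have "\<exists>z. z \<in> cball 1 \<rho> \<and> R h z \<and> \<bar>z - 1\<bar> \<le> B / q * h ^ (p - 1)"
      by blast
    then show ?case
      unfolding \<gamma>_def by (rule someI_ex)
  qed
  have "\<forall>\<^sub>F h in at_right 0. norm (\<gamma> h - 1) \<le> B / q * norm (h ^ (p - 1))"
    using \<gamma> eventually_at_right_less[of 0] by eventually_elim auto
  then have "(\<lambda>h. \<gamma> h - 1) \<in> O[at_right 0](\<lambda>h. h ^ (p - 1))"
    by (rule landau_o.bigI[rotated]) (use \<open>0 < B\<close> \<open>0 < q\<close> in simp)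
  moreover have "\<forall>\<^sub>F h in at_right 0. R h (\<gamma> h)"
    using \<gamma> by eventually_elim blast
  ultimately have "relaxation_parameter p \<eta> u_old u_new \<eta>_old \<eta>_new \<gamma>"
    unfolding relaxation_parameter_def R_def by blast
  moreover have "\<forall>\<^sub>F h in at_right 0. \<gamma>' h = \<gamma> h"
    if "relaxation_parameter p \<eta> u_old u_new \<eta>_old \<eta>_new \<gamma>'" for \<gamma>'
  proof -
    have "(\<lambda>h. \<gamma>' h - 1) \<in> O[at_right 0](\<lambda>h. h ^ (p - 1))" and R': "\<forall>\<^sub>F h in at_right 0. R h (\<gamma>' h)"
      using that unfolding relaxation_parameter_def R_def by auto
    then obtain C where "0 < C" and C: "\<forall>\<^sub>F h in at_right 0. \<bar>\<gamma>' h - 1\<bar> \<le> C * h ^ (p - 1)"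
      using bigo_at_right_powerE[of "\<lambda>h. \<gamma>' h - 1" "p - 1"] by metis
    show ?thesis
      using ev \<gamma> R' C eventually_at_right_less[of 0]
        eventually_at_right_0_le[of 1, OF zero_less_one]
        eventually_at_right_0_le[of "\<rho> / C", OF divide_pos_pos[OF \<rho>(1) \<open>0 < C\<close>]]
    proof eventually_elim
      case (elim h)
      \<comment> \<open>Again by \<open>p \<ge> 2\<close>, any competitor tends to \<open>1\<close>
        and ends up in the fixed ball, where the root is unique.\<close>
      have "h ^ (p - 1) \<le> h ^ 1"
        using elim \<open>2 \<le> p\<close> by (intro power_decreasing) auto
      then have "C * h ^ (p - 1) \<le> C * h"
        using \<open>0 < C\<close> by simp
      also have "\<dots> \<le> \<rho>"
        using elim \<open>0 < C\<close> by (simp add: field_simps)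
      finally have "\<gamma>' h \<in> cball 1 \<rho>"
        using elim by (simp add: dist_real_def abs_minus_commute)
      then show ?case
        using elim by blast
    qed
  qed
  ultimately show ?thesis
    by blast
qed

text \<open>Relaxation shifts the value by \<open>(\<gamma> - 1) *\<^sub>R (y' - y)\<close> and the
  time by \<open>(\<gamma> - 1) * (s' - s)\<close>. To first order the solution follows this time
  shift with velocity \<open>w\<close>, so only remainders survive: the error of the new value,
  \<open>\<gamma> - 1\<close> times the increment remainder, of order \<open>(p - 1) + 2\<close>,
  and a Taylor remainder of order \<open>2 * p\<close>.\<close>

lemma relaxed_value_error:
  fixes y y' w :: "'a::real_normed_vector" and \<gamma> s s' :: real
  assumes h: "0 \<le> h" "h \<le> 1" "1 \<le> p" and "0 \<le> M" "0 \<le> Q"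
    and rem: "norm (u (relax \<gamma> s s') - u s' - (relax \<gamma> s s' - s') *\<^sub>R w) \<le> M * (relax \<gamma> s s' - s')\<^sup>2"
    and new: "norm (y' - u s') \<le> B * h ^ (p + 1)"
    and inc: "norm ((y' - y) - (s' - s) *\<^sub>R w) \<le> Q * h\<^sup>2"
    and \<gamma>: "\<bar>\<gamma> - 1\<bar> \<le> G * h ^ (p - 1)"
    and step: "\<bar>s' - s\<bar> \<le> T * h"
  shows "norm (relax \<gamma> y y' - u (relax \<gamma> s s')) \<le> (B + G * Q + M * (G * T)\<^sup>2) * h ^ (p + 1)"
proof -
  have pp: "h ^ (p + 1) = h ^ (p - 1) * h\<^sup>2" "h ^ p = h ^ (p - 1) * h"
    using h(3) by (auto simp flip: power_add power_Suc2)
  have "\<bar>\<gamma> - 1\<bar> * norm ((y' - y) - (s' - s) *\<^sub>R w) \<le> G * h ^ (p - 1) * (Q * h\<^sup>2)"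
    using \<gamma> inc by (intro mult_mono) auto
  then have a: "norm ((\<gamma> - 1) *\<^sub>R ((y' - y) - (s' - s) *\<^sub>R w)) \<le> G * Q * h ^ (p + 1)"
    unfolding pp(1) by (simp add: mult_ac)
  have "\<bar>relax \<gamma> s s' - s'\<bar> = \<bar>\<gamma> - 1\<bar> * \<bar>s' - s\<bar>"
    by (simp add: relax_eq_new abs_mult)
  also have "\<dots> \<le> G * h ^ (p - 1) * (T * h)"
    using \<gamma> step by (intro mult_mono) auto
  also have "\<dots> = G * T * h ^ p"
    by (subst pp(2)) (simp add: mult_ac)
  finally have "(relax \<gamma> s s' - s')\<^sup>2 \<le> (G * T * h ^ p)\<^sup>2"
    using power_mono[OF _ abs_ge_zero, of _ _ 2] by fastforce
  also have "\<dots> = (G * T)\<^sup>2 * h ^ (2 * p)"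
    by (simp add: power_mult_distrib power_mult mult.commute[of 2 p])
  \<comment> \<open>The exponent \<open>2 * p\<close> is at least \<open>p + 1\<close> because
    \<open>p\<close> is at least \<open>1\<close>.\<close>
  also have "\<dots> \<le> (G * T)\<^sup>2 * h ^ (p + 1)"
    using h by (intro mult_left_mono power_decreasing) auto
  finally have "M * (relax \<gamma> s s' - s')\<^sup>2 \<le> M * (G * T)\<^sup>2 * h ^ (p + 1)"
    using mult_left_mono[OF _ \<open>0 \<le> M\<close>] by (simp add: mult.assoc)
  then have b: "norm (u (relax \<gamma> s s') - u s' - (relax \<gamma> s s' - s') *\<^sub>R w) \<le> M * (G * T)\<^sup>2 * h ^ (p + 1)"
    using rem by linarith
  \<comment> \<open>The multiples of \<open>w\<close> in the last two terms are equal and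
    cancel.\<close>
  have "relax \<gamma> y y' - u (relax \<gamma> s s') = (y' - u s') + (\<gamma> - 1) *\<^sub>R ((y' - y) - (s' - s) *\<^sub>R w)
      - (u (relax \<gamma> s s') - u s' - (relax \<gamma> s s' - s') *\<^sub>R w)"
    by (simp add: relax_eq_new scaleR_diff_right)
  also have "norm \<dots> \<le> norm (y' - u s') + norm ((\<gamma> - 1) *\<^sub>R ((y' - y) - (s' - s) *\<^sub>R w))
      + norm (u (relax \<gamma> s s') - u s' - (relax \<gamma> s s' - s') *\<^sub>R w)"
    by (meson add_right_mono norm_triangle_ineq norm_triangle_ineq4 order_trans)
  also have "\<dots> \<le> (B + G * Q + M * (G * T)\<^sup>2) * h ^ (p + 1)"
    using new a b by (simp add: algebra_simps)
  finally show ?thesis .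
qed

text \<open>Since \<open>\<gamma>\<close> is a function of \<open>h\<close>, uniqueness means
  agreement for all small \<open>h\<close>. \<open>nonstationary\<close> gives the increment exact
  order \<open>h\<close>, and \<open>nondegenerate\<close> keeps the slope of the residual away from
  zero on the scale \<open>h\<^sup>2\<close>. For invariants, with
  \<open>\<eta>_new = \<eta>_old\<close>, the latter holds with
  \<open>\<kappa> = \<bar>c\<bar>\<close>.\<close>

theorem theorem2p14:
  fixes f :: "'a::banach \<Rightarrow> 'a" and u :: "real \<Rightarrow> 'a" and J :: "real set"
    and \<eta> :: "'a \<Rightarrow> real"
    and \<psi> :: "'a time_integrator" and k p m :: nat
    and t :: "real \<Rightarrow> nat \<Rightarrow> real" and v :: "real \<Rightarrow> nat \<Rightarrow> 'a"
    and \<nu> :: "nat \<Rightarrow> real" and \<eta>_new :: "real \<Rightarrow> real" and c :: real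
  defines "t_new \<equiv> \<lambda>h. t h 1 + h"
    and "u_new \<equiv> \<lambda>h. method_step \<psi> k f v h"
    and "t_old \<equiv> \<lambda>h. old_average m \<nu> (t h)"
    and "u_old \<equiv> \<lambda>h. old_average m \<nu> (v h)"
    and "\<eta>_old \<equiv> \<lambda>h. old_average m \<nu> (\<lambda>j. \<eta> (v h j))"
  assumes "smooth f" and "smooth \<eta>"
    and "solves_ode f u J" and nonstationary: "\<forall>s\<in>J. f (u s) \<noteq> 0"
    and "k \<ge> 1" and "m \<ge> 1" and "p \<ge> 2"
    and "\<forall>i<m. \<nu> i \<ge> 0" and "(\<Sum>i<m. \<nu> i) = 1"
    and "previous_times J (max k m) t"
    and "accurate_values p (max k m) u t v"
    and "has_order \<psi> k f t p"
    and "(\<lambda>h. \<eta>_new h - \<eta> (u_new h)) \<in> O[at_right 0](\<lambda>h. h ^ (p + 1))"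
    and "(\<lambda>h. frechet_derivative \<eta> (at (u_new h)) (u_new h - u_old h) / norm (u_new h - u_old h)
            - c * h) \<in> O[at_right 0](\<lambda>h. h ^ 2)"
    and "c \<noteq> 0"
    and nondegenerate: "\<exists>\<kappa>>0. \<forall>\<^sub>F h in at_right 0.
            \<kappa> * h \<le> \<bar>c * h - (\<eta>_new h - \<eta>_old h) / norm (u_new h - u_old h)\<bar>"
  shows "\<exists>\<gamma>. relaxation_parameter p \<eta> u_old u_new \<eta>_old \<eta>_new \<gamma> \<and>
           (\<forall>\<gamma>'. relaxation_parameter p \<eta> u_old u_new \<eta>_old \<eta>_new \<gamma>' \<longrightarrow>
              (\<forall>\<^sub>F h in at_right 0. \<gamma>' h = \<gamma> h)) \<and>
           (\<lambda>h. norm (relax (\<gamma> h) (u_old h) (u_new h) - u (relax (\<gamma> h) (t_old h) (t_new h))))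
             \<in> O[at_right 0](\<lambda>h. h ^ (p + 1))"
proof -
  note smooth_f = \<open>smooth f\<close> and ode = \<open>solves_ode f u J\<close> and p = \<open>2 \<le> p\<close>
  note \<nu> = \<open>\<forall>i<m. 0 \<le> \<nu> i\<close> \<open>(\<Sum>i<m. \<nu> i) = 1\<close>
  define N where "N = max k m"
  have N: "1 \<le> N" "k \<le> N" "m \<le> N"
    using \<open>1 \<le> k\<close> by (auto simp: N_def)
  have times: "previous_times J N t" and vals: "accurate_values p N u t v"
    using \<open>previous_times J (max k m) t\<close> \<open>accurate_values p (max k m) u t v\<close> by (auto simp: N_def)
  obtain a b where "{a..b} \<subseteq> J" and ab: "\<forall>\<^sub>F h in at_right 0. \<forall>j\<in>{1..N}. t h j \<in> {a..b}"
    using times unfolding previous_times_def by blast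
  \<comment> \<open>For some \<open>h\<close> the time with index \<open>1\<close> lies in the
    interval, which is therefore nonempty.\<close>
  have "a \<le> b"
    using eventually_happens'[OF trivial_limit_at_right_real ab] N by fastforce
  obtain e where "0 < e" and sub: "{a - e..b + e} \<subseteq> J"
    using open_interval_enlarge[OF _ _ \<open>{a..b} \<subseteq> J\<close> \<open>a \<le> b\<close>] ode unfolding solves_ode_def by blast
  define I where "I = {a - e..b + e}"
  have "I \<noteq> {}" "compact I"
    using \<open>a \<le> b\<close> \<open>0 < e\<close> by (auto simp: I_def)
  note cont = solves_ode_continuous[OF smooth_f ode sub, folded I_def]
  obtain M where "0 \<le> M" and M: "\<And>s s'. s \<in> I \<Longrightarrow> s' \<in> I \<Longrightarrow>
      norm (u s - u s' - (s - s') *\<^sub>R f (u s')) \<le> M * (s - s')\<^sup>2"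
    using solves_ode_quadratic_remainder[OF smooth_f ode sub] unfolding I_def by metis
  \<comment> \<open>The speed of the solution attains its minimum on the compact interval, and
    \<open>nonstationary\<close> makes this minimum positive.\<close>
  obtain l where "0 < l" and l: "\<And>s. s \<in> I \<Longrightarrow> l \<le> norm (f (u s))"
  proof -
    obtain s where "s \<in> I" "\<forall>r\<in>I. norm (f (u s)) \<le> norm (f (u r))"
      using continuous_attains_inf[OF \<open>compact I\<close> \<open>I \<noteq> {}\<close> continuous_on_norm[OF cont(2)]] by metis
    then show ?thesis
      using that[of "norm (f (u s))"] nonstationary sub unfolding I_def by auto
  qed
  obtain F where "0 < F" and F: "\<And>s. s \<in> I \<Longrightarrow> norm (f (u s)) \<le> F"
    using compact_imp_bounded[OF compact_continuous_image[OF cont(2) \<open>compact I\<close>]]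
    unfolding bounded_pos by (metis imageI)
  obtain \<eta>' where \<eta>': "\<And>x. (\<eta> has_derivative \<eta>' x) (at x)"
    "\<And>K. compact K \<Longrightarrow> \<exists>r>0. \<exists>B\<ge>0. \<forall>x\<in>K. \<forall>y\<in>ball x r. \<forall>z\<in>ball x r. \<forall>w.
        norm (\<eta>' y w - \<eta>' z w) \<le> B * norm (y - z) * norm w"
    using smooth_differential[OF \<open>smooth \<eta>\<close>] by metis
  obtain r L where "0 < r" "0 \<le> L" and L: "\<And>s y z w. s \<in> I \<Longrightarrow> y \<in> ball (u s) r \<Longrightarrow> z \<in> ball (u s) r \<Longrightarrow>
      \<bar>\<eta>' y w - \<eta>' z w\<bar> \<le> L * norm (y - z) * norm w"
    using \<eta>'(2)[OF compact_continuous_image[OF cont(1) \<open>compact I\<close>]] by auto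
  obtain C where "0 < C" and
    C: "\<forall>\<^sub>F h in at_right 0. \<forall>j\<in>{1..N}. 0 \<le> t h 1 - t h j \<and> t h 1 - t h j \<le> C * h"
    by (rule previous_times_spread[OF times])
  obtain A where "0 < A" and
    A: "\<forall>\<^sub>F h in at_right 0. \<forall>j\<in>{1..N}. norm (v h j - u (t h j)) \<le> A * h ^ (p + 1)"
    by (rule accurate_values_uniform[OF vals])
  have "(\<lambda>h. norm (u_new h - u (t_new h))) \<in> O[at_right 0](\<lambda>h. h ^ (p + 1))"
    using \<open>has_order \<psi> k f t p\<close> ode previous_times_mono[OF times N(2)] accurate_values_mono[OF vals N(2)]
    unfolding has_order_def u_new_def t_new_def by blast
  then obtain B where "0 < B" and B: "\<forall>\<^sub>F h in at_right 0. \<bar>norm (u_new h - u (t_new h))\<bar> \<le> B * h ^ (p + 1)"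
    by (rule bigo_at_right_powerE)
  \<comment> \<open>\<open>C\<close> covers the spread of the previous times and \<open>1\<close>
    the step to the new time; \<open>Q\<close> is the constant that the increment expansion
    produces.\<close>
  define T where "T = C + 1"
  define Q where "Q = A + B + M * T\<^sup>2"
  have "0 < T" "0 < Q"
    using \<open>0 < A\<close> \<open>0 < B\<close> \<open>0 < C\<close> \<open>0 \<le> M\<close> by (auto simp: T_def Q_def intro!: add_pos_nonneg)
  have small: "\<forall>\<^sub>F h in at_right 0. h \<le> x / y" if "0 < x" "0 < y" for x y :: real
    using that by (intro eventually_at_right_0_le) simp
  have hpow: "h ^ (p + 1) \<le> h\<^sup>2" if "0 < h" "h \<le> 1" for h :: real
    using p that by (intro power_decreasing) auto
  \<comment> \<open>The new time uses only half of the margin \<open>e\<close>; the other half is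
    reserved for the relaxed time.\<close>
  have basic: "\<forall>\<^sub>F h in at_right 0. 0 < h \<and> h \<le> 1 \<and> t_new h \<in> {a - e / 2..b + e / 2} \<and>
      norm (u_new h - u (t_new h)) \<le> B * h ^ (p + 1) \<and> h \<le> t_new h - t_old h \<and> t_new h - t_old h \<le> T * h \<and>
      norm ((u_new h - u_old h) - (t_new h - t_old h) *\<^sub>R f (u (t_new h))) \<le> Q * h\<^sup>2"
    using ab C A B eventually_at_right_less[of 0] eventually_at_right_0_le[of 1, OF zero_less_one]
      small[of e 2, OF \<open>0 < e\<close> zero_less_numeral]
  proof eventually_elim
    case (elim h)
    have tn: "t_new h \<in> {a - e / 2..b + e / 2}"
      using bspec[OF elim(1), of 1] N elim(5,7) \<open>0 < e\<close> by (auto simp: t_new_def)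
    have gaps: "h \<le> t_new h - t h j" "t_new h - t h j \<le> T * h" if "j \<in> {1..m}" for j
      using bspec[OF elim(2), of j] that N by (auto simp: t_new_def T_def algebra_simps)
    have avg: "t_new h - t_old h = old_average m \<nu> (\<lambda>j. t_new h - t h j)"
      unfolding t_old_def by (rule old_average_linear(1)[OF \<nu>(2)])
    \<comment> \<open>No previous time is later than \<open>t h 1\<close>, so each is at least
      \<open>h\<close> before the new time, and averaging preserves this. The lower bound on the
      increment rests on it.\<close>
    have lo: "h \<le> t_new h - t_old h"
      unfolding avg using gaps by (intro old_average_ge[OF \<nu>]) auto
    have "norm (t_new h - t_old h) \<le> T * h"
      unfolding avg by (rule norm_old_average_le[OF \<nu>]) (use gaps elim(5) in fastforce)
    then have hi: "t_new h - t_old h \<le> T * h"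
      by simp
    have "norm ((u_new h - u_old h) - (t_new h - t_old h) *\<^sub>R f (u (t_new h))) \<le> Q * h\<^sup>2"
      unfolding u_old_def t_old_def Q_def
    proof (rule increment_expansion[OF \<nu> \<open>0 \<le> M\<close>])
      fix j assume j: "j \<in> {1..m}"
      have tj: "t h j \<in> I"
        using bspec[OF elim(1), of j] j N \<open>0 < e\<close> by (auto simp: I_def)
      have "t_new h \<in> I"
        using tn \<open>0 < e\<close> by (auto simp: I_def)
      then show "norm (u (t h j) - u (t_new h) - (t h j - t_new h) *\<^sub>R f (u (t_new h)))
          \<le> M * (t h j - t_new h)\<^sup>2"
        using M tj by blast
      show "\<bar>t h j - t_new h\<bar> \<le> T * h"
        using gaps[OF j] elim(5) by auto
      have "A * h ^ (p + 1) \<le> A * h\<^sup>2"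
        using hpow[OF elim(5,6)] \<open>0 < A\<close> by simp
      then show "norm (v h j - u (t h j)) \<le> A * h\<^sup>2"
        using bspec[OF elim(3), of j] j N by fastforce
    next
      have "B * h ^ (p + 1) \<le> B * h\<^sup>2"
        using hpow[OF elim(5,6)] \<open>0 < B\<close> by simp
      then show "norm (u_new h - u (t_new h)) \<le> B * h\<^sup>2"
        using elim(4) by simp
    qed
    then show ?case
      using elim(4-6) tn lo hi by simp
  qed
  have tnI: "t_new h \<in> I" if "t_new h \<in> {a - e / 2..b + e / 2}" for h
    using that \<open>0 < e\<close> by (auto simp: I_def)
  \<comment> \<open>The increment is \<open>\<tau> *\<^sub>R w\<close> up to
    \<open>Q * h\<^sup>2\<close>, with \<open>\<tau>\<close> between \<open>h\<close> and
    \<open>T * h\<close> and the norm of \<open>w\<close> between \<open>l\<close> and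
    \<open>F\<close>. For small \<open>h\<close> the remainder takes at most half of the lower bound
    \<open>l * h\<close>.\<close>
  have bounds: "\<forall>\<^sub>F h in at_right 0. l / 2 * h \<le> norm (u_new h - u_old h) \<and>
      norm (u_new h - u_old h) \<le> (T * F + Q) * h"
    using basic small[of "l / 2" Q, OF half_gt_zero[OF \<open>0 < l\<close>] \<open>0 < Q\<close>]
  proof eventually_elim
    case (elim h)
    define d where "d = u_new h - u_old h"
    define \<tau> where "\<tau> = t_new h - t_old h"
    define w where "w = f (u (t_new h))"
    have h: "0 < h" "h \<le> 1" and \<tau>: "h \<le> \<tau>" "\<tau> \<le> T * h" and dw: "norm (d - \<tau> *\<^sub>R w) \<le> Q * h\<^sup>2"
      and w: "l \<le> norm w" "norm w \<le> F"
      using elim(1) l[OF tnI] F[OF tnI] by (auto simp: d_def \<tau>_def w_def)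
    have "Q * h \<le> l / 2"
      using elim(2) \<open>0 < Q\<close> by (simp add: field_simps)
    then have q: "Q * h\<^sup>2 \<le> l / 2 * h"
      using mult_right_mono[of "Q * h" "l / 2" h] h by (simp add: power2_eq_square mult.assoc)
    have q': "Q * h\<^sup>2 \<le> Q * h"
      using h \<open>0 < Q\<close> by (simp add: power2_eq_square mult_left_le)
    have "h * l \<le> \<tau> * norm w" "\<tau> * norm w \<le> (T * h) * F"
      using \<tau> w h \<open>0 < l\<close> \<open>0 < T\<close> by (auto intro!: mult_mono)
    moreover have "\<bar>\<tau>\<bar> = \<tau>"
      using \<tau> h by simp
    moreover have "norm d \<le> norm (\<tau> *\<^sub>R w) + norm (d - \<tau> *\<^sub>R w)"
      "norm (\<tau> *\<^sub>R w) \<le> norm d + norm (d - \<tau> *\<^sub>R w)"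
      using norm_triangle_sub[of d "\<tau> *\<^sub>R w"] norm_triangle_sub[of "\<tau> *\<^sub>R w" d]
      by (simp_all add: norm_minus_commute)
    ultimately have "l / 2 * h \<le> norm d" "norm d \<le> T * F * h + Q * h"
      using dw q q' by (simp_all add: mult_ac)
    then show ?case
      by (simp add: d_def distrib_right)
  qed
  \<comment> \<open>The Lipschitz balls are centred on the solution curve. The new value is within
    \<open>r / 3\<close> of it, and \<open>r / 3 + r / 2 < r\<close>, so a ball of radius
    \<open>r / 2\<close> around the new value fits inside.\<close>
  have lip: "\<forall>\<^sub>F h in at_right 0. \<forall>y\<in>ball (u_new h) (r / 2). \<forall>w.
      \<bar>\<eta>' y w - \<eta>' (u_new h) w\<bar> \<le> L * norm (y - u_new h) * norm w"
    using basic small[of "r / 3" B, OF _ \<open>0 < B\<close>, OF divide_pos_pos[OF \<open>0 < r\<close> zero_less_numeral]]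
  proof eventually_elim
    case (elim h)
    have h: "0 < h" "h \<le> 1"
      using elim(1) by auto
    have "h ^ (p + 1) \<le> h ^ 1"
      by (rule power_decreasing) (use h in auto)
    then have "B * h ^ (p + 1) \<le> B * h"
      using \<open>0 < B\<close> by simp
    also have "\<dots> \<le> r / 3"
      using elim(2) \<open>0 < B\<close> by (simp add: field_simps)
    finally have close: "dist (u (t_new h)) (u_new h) \<le> r / 3"
      using elim(1) by (simp add: dist_norm norm_minus_commute)
    then have "y \<in> ball (u (t_new h)) r" if "y \<in> ball (u_new h) (r / 2)" for y
      using that dist_triangle[of "u (t_new h)" y "u_new h"] \<open>0 < r\<close> by simp
    moreover have "u_new h \<in> ball (u (t_new h)) r"
      using close \<open>0 < r\<close> by simp
    moreover have "t_new h \<in> I"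
      using elim(1) tnI by blast
    ultimately show ?case
      using L[of "t_new h" _ "u_new h"] by simp
  qed
  obtain \<kappa> where "0 < \<kappa>" and
    \<kappa>: "\<forall>\<^sub>F h in at_right 0. \<kappa> * h \<le> \<bar>c * h - (\<eta>_new h - \<eta>_old h) / norm (u_new h - u_old h)\<bar>"
    using nondegenerate by blast
  have slope: "(\<lambda>h. \<eta>' (u_new h) (u_new h - u_old h) / norm (u_new h - u_old h) - c * h)
      \<in> O[at_right 0](\<lambda>h. h ^ 2)"
    using \<open>(\<lambda>h. frechet_derivative \<eta> (at (u_new h)) (u_new h - u_old h) / norm (u_new h - u_old h)
        - c * h) \<in> O[at_right 0](\<lambda>h. h ^ 2)\<close>
    by (simp flip: frechet_derivative_at[OF \<eta>'(1)])
  have pos: "0 < r / 2" "0 < l / 2" "0 < T * F + Q"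
    using \<open>0 < r\<close> \<open>0 < l\<close> \<open>0 < T\<close> \<open>0 < F\<close> \<open>0 < Q\<close> by (auto intro: add_pos_pos)
  have lower: "\<forall>\<^sub>F h in at_right 0. l / 2 * h \<le> norm (u_new h - u_old h)"
    and upper: "\<forall>\<^sub>F h in at_right 0. norm (u_new h - u_old h) \<le> (T * F + Q) * h"
    using bounds by (auto elim: eventually_mono)
  obtain \<gamma> where \<gamma>: "relaxation_parameter p \<eta> u_old u_new \<eta>_old \<eta>_new \<gamma>" and
    unique: "\<forall>\<gamma>'. relaxation_parameter p \<eta> u_old u_new \<eta>_old \<eta>_new \<gamma>' \<longrightarrow>
      (\<forall>\<^sub>F h in at_right 0. \<gamma>' h = \<gamma> h)"
    using relaxation_parameter_exists_unique[OF p \<eta>'(1) pos(1) \<open>0 \<le> L\<close> lip pos(2,3) lower upper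
        \<open>(\<lambda>h. \<eta>_new h - \<eta> (u_new h)) \<in> O[at_right 0](\<lambda>h. h ^ (p + 1))\<close> slope \<open>0 < \<kappa>\<close> \<kappa>]
    by (elim exE conjE)
  obtain G where "0 < G" and G: "\<forall>\<^sub>F h in at_right 0. \<bar>\<gamma> h - 1\<bar> \<le> G * h ^ (p - 1)"
    using bigo_at_right_powerE[of "\<lambda>h. \<gamma> h - 1" "p - 1"] \<gamma> unfolding relaxation_parameter_def by metis
  have "\<forall>\<^sub>F h in at_right 0. norm (relax (\<gamma> h) (u_old h) (u_new h) - u (relax (\<gamma> h) (t_old h) (t_new h)))
      \<le> (B + G * Q + M * (G * T)\<^sup>2) * h ^ (p + 1)"
    using basic G small[of "e / 2" "G * T", OF half_gt_zero[OF \<open>0 < e\<close>] mult_pos_pos[OF \<open>0 < G\<close> \<open>0 < T\<close>]]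
  proof eventually_elim
    case (elim h)
    have h: "0 < h" "h \<le> 1" and \<tau>: "\<bar>t_new h - t_old h\<bar> \<le> T * h"
      using elim(1) by auto
    \<comment> \<open>Keeps the relaxed time within \<open>e / 2\<close> of the new time, hence in
      \<open>I\<close>, where the Taylor estimate is available.\<close>
    have "\<bar>relax (\<gamma> h) (t_old h) (t_new h) - t_new h\<bar> = \<bar>\<gamma> h - 1\<bar> * \<bar>t_new h - t_old h\<bar>"
      by (simp add: relax_eq_new abs_mult)
    also have "\<dots> \<le> G * (T * h)"
    proof (rule mult_mono)
      have "h ^ (p - 1) \<le> 1"
        using h by (simp add: power_le_one)
      then have "G * h ^ (p - 1) \<le> G"
        using \<open>0 < G\<close> by (simp add: mult_left_le)
      then show "\<bar>\<gamma> h - 1\<bar> \<le> G"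
        using elim(2) by simp
    qed (use \<tau> \<open>0 < G\<close> in auto)
    also have "\<dots> \<le> e / 2"
      using elim(3) \<open>0 < G\<close> \<open>0 < T\<close> by (simp add: field_simps)
    finally have "relax (\<gamma> h) (t_old h) (t_new h) \<in> I"
      using elim(1) by (auto simp: I_def; linarith)
    then have "norm (u (relax (\<gamma> h) (t_old h) (t_new h)) - u (t_new h)
        - (relax (\<gamma> h) (t_old h) (t_new h) - t_new h) *\<^sub>R f (u (t_new h)))
        \<le> M * (relax (\<gamma> h) (t_old h) (t_new h) - t_new h)\<^sup>2"
      using M tnI elim(1) by blast
    then show ?case
      using elim(1,2) h \<tau> p \<open>0 \<le> M\<close> \<open>0 < Q\<close>
      by (intro relaxed_value_error[where u = u and w = "f (u (t_new h))"]; simp)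
  qed
  then have "\<forall>\<^sub>F h in at_right 0.
      norm (norm (relax (\<gamma> h) (u_old h) (u_new h) - u (relax (\<gamma> h) (t_old h) (t_new h))))
      \<le> (B + G * Q + M * (G * T)\<^sup>2) * norm (h ^ (p + 1))"
    using eventually_at_right_less[of 0] by eventually_elim simp
  moreover have "0 < B + G * Q + M * (G * T)\<^sup>2"
    using \<open>0 < B\<close> \<open>0 < G\<close> \<open>0 < Q\<close> \<open>0 \<le> M\<close> by (intro add_pos_nonneg add_pos_pos) auto
  ultimately have "(\<lambda>h. norm (relax (\<gamma> h) (u_old h) (u_new h) - u (relax (\<gamma> h) (t_old h) (t_new h))))
      \<in> O[at_right 0](\<lambda>h. h ^ (p + 1))"
    by (intro landau_o.bigI)
  with \<gamma> unique show ?thesis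
    by (intro exI[of _ \<gamma>] conjI)
qed

end
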